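(* Let $\Lambda\subset\mathbb{C}$ be an unbounded set with a unique limit direction at infinity, $P(\Lambda)=\{s_\omega\}$, and let $\{\lambda_n\}\subset\Lambda$ be any sequence with $|\lambda_{n+1}|>2|\lambda_n|$ for all $n$. Let $M=\{\mu_k\}_{k\ge1}\subset\mathbb{C}$ be a countably infinite set of nodes with multiplicities $m_k\in\mathbb{N}$, such that no point of $M$ is a limit point of $M$, and such that for every $c\in\mathbb{R}$ the line $\{z\in\mathbb{C}:\operatorname{Re}(s_\omega z)=c\}$ contains at most one node of $M$. Let $d(s_\omega,M)=\sup_{k}\operatorname{Re}(s_\omega\mu_k)\in\mathbb{R}\cup\{+\infty\}$ and $\Pi=\{z\in\mathbb{C}:\operatorname{Re}(s_\omega z)<d(s_\omega,M)\}$. Say that the interpolation problem is soluble if for arbitrary data $b_k^j\in\mathbb{C}$ ($k\in\mathbb{N}$, $0\le j\le m_k-1$) there exists a series $\sum_{n}c_ne^{\lambda_nz}$ that converges absolutely in a neighborhood of every node $\mu_k$ and whose sum $U$ satisfies $U^{(j)}(\mu_k)=b_k^j$ for all $k$ and $0\le j\le m_k-1$ (such a series converges absolutely in $\Pi$, so $U\in H(\Pi)$). Then: 1. If $d(s_\omega,M)=+\infty$ (so $\Pi=\mathbb{C}$), the interpolation problem is soluble if and only if $\lim_{k\to\infty}\operatorname{Re}(s_\omega\mu_k)=+\infty$. 2. If $d(s_\omega,M)<+\infty$ (so $\Pi$ is a half-plane), the interpolation problem is soluble if and only if $\operatorname{Re}(s_\omega\mu_k)<d(s_\omega,M)$ for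 all $k$ and $\lim_{k\to\infty}\operatorname{Re}(s_\omega\mu_k)=d(s_\omega,M)$.
   Context: $\mathbb{S}=\{s\in\mathbb{C}:|s|=1\}$. For an unbounded set $X\subset\mathbb{C}$, the set $P(X)\subset\mathbb{S}$ of limit directions at infinity consists of all $s\in\mathbb{S}$ such that $s=\lim_{k\to\infty}x_k/|x_k|$ for some sequence $\{x_k\}\subset X$ with $x_k\to\infty$. $H(\Pi)$ denotes the space of holomorphic functions on $\Pi$. The limits over $k\to\infty$ are limits along the (injective) enumeration of $M$, i.e. convergence along the filter of cofinite subsets of $M$. *)

theory Defs
  imports "HOL-Analysis.Analysis"
begin

definition limit_directions :: "complex set \<Rightarrow> complex set" where
  "limit_directions X = {s. \<exists>x :: nat \<Rightarrow> complex. (\<forall>k. x k \<in> X) \<and>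
      filterlim x at_infinity sequentially \<and> (\<lambda>k. x k / of_real (norm (x k))) \<longlonglongrightarrow> s}"

definition exp_series :: "(nat \<Rightarrow> complex) \<Rightarrow> (nat \<Rightarrow> complex) \<Rightarrow> complex \<Rightarrow> complex" where
  "exp_series c lam z = (\<Sum>n. c n * exp (lam n * z))"

definition interp_soluble ::
  "(nat \<Rightarrow> complex) \<Rightarrow> (nat \<Rightarrow> complex) \<Rightarrow> (nat \<Rightarrow> nat) \<Rightarrow> bool" where
  "interp_soluble lam mu m \<longleftrightarrow>
     (\<forall>b :: nat \<Rightarrow> nat \<Rightarrow> complex. \<exists>c :: nat \<Rightarrow> complex.
        (\<forall>k. \<exists>r>0. \<forall>z\<in>ball (mu k) r. summable (\<lambda>n. norm (c n * exp (lam n * z)))) \<and>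
        (\<forall>k j. j < m k \<longrightarrow> (deriv ^^ j) (exp_series c lam) (mu k) = b k j))"

end

theory Submission
  imports Defs "HOL-Complex_Analysis.Complex_Analysis"
begin

text \<open>
  Both parts reduce to one criterion: the problem is soluble iff only finitely many nodes satisfy
  \<open>Re (s \<mu>) \<le> Re (s \<mu>\<^sub>0)\<close>, for every node \<open>\<mu>\<^sub>0\<close>.

  Necessity: a solution converges at some point \<open>p\<^sub>i = \<mu>\<^sub>0 + cnj s / (i + 1)\<close> slightly beyond \<open>\<mu>\<^sub>0\<close>, so its
  values at the nodes \<open>\<mu>\<^sub>k\<close> not beyond \<open>\<mu>\<^sub>0\<close> are at most a constant times
  \<open>\<Sum>\<^sub>n \<bar>exp (\<lambda>\<^sub>n (\<mu>\<^sub>k - p\<^sub>i))\<bar>\<close>, a bound known before the data are chosen.  Data growing faster than all these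
  bounds diagonally in \<open>i\<close> and \<open>k\<close> rule out infinitely many such nodes.

  Sufficiency: order the conditions first by \<open>Re (s \<mu>)\<close>, then by the order of the derivative.  Their
  coefficients \<open>w\<^sub>q(n) = \<lambda>\<^sub>n\<^sup>j exp (\<lambda>\<^sub>n \<mu>)\<close> satisfy \<open>w\<^sub>q(n) / w\<^sub>q\<^sub>+\<^sub>1(n) \<rightarrow> 0\<close>, and Polya's theorem on infinite systems
  of linear equations gives a solution that converges absolutely in every equation.
\<close>

section \<open>Polya's theorem on infinite linear systems\<close>

text \<open>\<open>w q n\<close> is the coefficient of the unknown \<open>c n\<close> in equation
  \<open>q\<close>. Far out each row is negligible against the next, so a distant unknown can adjust
  a later equation with little effect on the earlier ones.\<close>

locale polya_system =
  fixes w :: "nat \<Rightarrow> nat \<Rightarrow> complex"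
  assumes w_0_nonzero: "w 0 n \<noteq> 0"
    and w_eventually_nonzero: "eventually (\<lambda>n. w q n \<noteq> 0) sequentially"
    and w_ratio_Suc: "(\<lambda>n. w q n / w (Suc q) n) \<longlonglongrightarrow> 0"
begin

text \<open>Solutions are sought where every equation converges absolutely; on this space the
  \<open>func i\<close> are linear and the \<open>wnorm i\<close> are seminorms.\<close>

definition adm :: "(nat \<Rightarrow> complex) \<Rightarrow> bool" where
  "adm c \<longleftrightarrow> (\<forall>i. summable (\<lambda>n. norm (c n * w i n)))"

definition func :: "nat \<Rightarrow> (nat \<Rightarrow> complex) \<Rightarrow> complex" where
  "func i c = (\<Sum>n. c n * w i n)"

definition wnorm :: "nat \<Rightarrow> (nat \<Rightarrow> complex) \<Rightarrow> real" where
  "wnorm i c = (\<Sum>n. norm (c n * w i n))"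

lemma w_ratio: "i < q \<Longrightarrow> (\<lambda>n. w i n / w q n) \<longlonglongrightarrow> 0"
proof (induction q)
  case 0
  then show ?case by simp
next
  case (Suc q)
  show ?case
  proof (cases "i = q")
    case True
    then show ?thesis by (simp add: w_ratio_Suc)
  next
    case False
    then have "(\<lambda>n. w i n / w q n) \<longlonglongrightarrow> 0" using Suc by simp
    from tendsto_mult[OF this w_ratio_Suc[of q]]
    have "(\<lambda>n. w i n / w q n * (w q n / w (Suc q) n)) \<longlonglongrightarrow> 0" by simp
    \<comment> \<open>The middle factor \<open>w q n\<close> cancels only where it is nonzero, hence
      an eventual identity.\<close>
    moreover have "eventually (\<lambda>n. w i n / w q n * (w q n / w (Suc q) n) = w i n / w (Suc q) n) sequentially"
      using w_eventually_nonzero[of q] by eventually_elim simp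
    ultimately show ?thesis by (rule Lim_transform_eventually)
  qed
qed

lemma adm_summable_norm: "adm c \<Longrightarrow> summable (\<lambda>n. norm (c n * w i n))"
  by (simp add: adm_def)

lemma adm_summable: "adm c \<Longrightarrow> summable (\<lambda>n. c n * w i n)"
  by (rule summable_norm_cancel) (simp add: adm_summable_norm)

lemma wnorm_nonneg: "adm c \<Longrightarrow> 0 \<le> wnorm i c"
  unfolding wnorm_def by (intro suminf_nonneg adm_summable_norm) auto

lemma adm_add: "adm (\<lambda>n. c n + d n)" if "adm c" "adm d"
  unfolding adm_def
proof
  fix i
  have "summable (\<lambda>n. norm (c n * w i n) + norm (d n * w i n))"
    by (intro summable_add that[THEN adm_summable_norm])
  then show "summable (\<lambda>n. norm ((c n + d n) * w i n))"
    by (rule summable_comparison_test'[of _ 0]) (simp add: distrib_right norm_triangle_ineq)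
qed

lemma func_add: "adm c \<Longrightarrow> adm d \<Longrightarrow> func i (\<lambda>n. c n + d n) = func i c + func i d"
  unfolding func_def by (simp add: distrib_right suminf_add[symmetric] adm_summable)

lemma wnorm_add_le:
  assumes "adm c" "adm d"
  shows "wnorm i (\<lambda>n. c n + d n) \<le> wnorm i c + wnorm i d"
  unfolding wnorm_def suminf_add[OF assms[THEN adm_summable_norm]]
  by (intro suminf_le adm_summable_norm adm_add summable_add assms)
    (simp add: distrib_right norm_triangle_ineq)

lemma adm_cmult: "adm c \<Longrightarrow> adm (\<lambda>n. a * c n)"
  unfolding adm_def by (simp add: norm_mult mult.assoc summable_mult)

lemma func_cmult: "adm c \<Longrightarrow> func i (\<lambda>n. a * c n) = a * func i c"
  unfolding func_def by (simp add: mult.assoc suminf_mult adm_summable)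

lemma wnorm_cmult: "adm c \<Longrightarrow> wnorm i (\<lambda>n. a * c n) = norm a * wnorm i c"
  unfolding wnorm_def using suminf_mult[OF adm_summable_norm, of c "norm a" i]
  by (simp add: norm_mult mult.assoc)

lemma adm_zero: "adm (\<lambda>n. 0)"
  by (simp add: adm_def)

lemma func_zero: "func i (\<lambda>n. 0) = 0"
  by (simp add: func_def)

lemma wnorm_zero: "wnorm i (\<lambda>n. 0) = 0"
  by (simp add: wnorm_def)

lemma adm_sum: "(\<And>p. p \<in> A \<Longrightarrow> adm (c p)) \<Longrightarrow> adm (\<lambda>n. \<Sum>p\<in>A. c p n)"
  by (induction A rule: infinite_finite_induct) (auto simp: adm_zero adm_add)

lemma func_sum:
  "(\<And>p. p \<in> A \<Longrightarrow> adm (c p)) \<Longrightarrow> func i (\<lambda>n. \<Sum>p\<in>A. c p n) = (\<Sum>p\<in>A. func i (c p))"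
  by (induction A rule: infinite_finite_induct) (auto simp: func_zero func_add adm_sum)

lemma wnorm_sum_le:
  "(\<And>p. p \<in> A \<Longrightarrow> adm (c p)) \<Longrightarrow> wnorm i (\<lambda>n. \<Sum>p\<in>A. c p n) \<le> (\<Sum>p\<in>A. wnorm i (c p))"
proof (induction A rule: infinite_finite_induct)
  case (insert x F)
  then have "wnorm i (\<lambda>n. c x n + (\<Sum>p\<in>F. c p n)) \<le> wnorm i (c x) + wnorm i (\<lambda>n. \<Sum>p\<in>F. c p n)"
    by (intro wnorm_add_le adm_sum) auto
  also have "\<dots> \<le> wnorm i (c x) + (\<Sum>p\<in>F. wnorm i (c p))"
    using insert by auto
  finally show ?case using insert by simp
qed (auto simp: wnorm_zero)

lemma adm_lincomb: "(\<And>p. p \<in> A \<Longrightarrow> adm (c p)) \<Longrightarrow> adm (\<lambda>n. \<Sum>p\<in>A. a p * c p n)"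
  by (intro adm_sum adm_cmult)

lemma func_lincomb:
  "(\<And>p. p \<in> A \<Longrightarrow> adm (c p)) \<Longrightarrow>
    func i (\<lambda>n. \<Sum>p\<in>A. a p * c p n) = (\<Sum>p\<in>A. a p * func i (c p))"
  by (subst func_sum) (simp_all add: adm_cmult func_cmult)

lemma adm_unit: "adm (\<lambda>n. of_bool (n = N))"
  unfolding adm_def by (intro allI summable_finite[of "{N}"]) auto

lemma func_unit: "func i (\<lambda>n. of_bool (n = N)) = w i N"
  unfolding func_def by (subst suminf_finite[of "{N}"]) auto

lemma wnorm_unit: "wnorm i (\<lambda>n. of_bool (n = N)) = norm (w i N)"
  unfolding wnorm_def by (subst suminf_finite[of "{N}"]) auto

lemma small_correction:
  assumes E: "\<And>i. i < q \<Longrightarrow> adm (E i)"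
    and dual: "\<And>i j. i < q \<Longrightarrow> j < q \<Longrightarrow> func j (E i) = of_bool (i = j)"
    and "0 < e"
  obtains c where "adm c" "\<And>j. j < q \<Longrightarrow> func j c = 0" "func q c = a"
    "\<And>j. j < q \<Longrightarrow> wnorm j c \<le> e"
proof -
  \<comment> \<open>The \<open>N\<close>-th unit vector, with its values under the first \<open>q\<close> functionals cancelled by the dual
    system; as \<open>N \<rightarrow> \<infinity>\<close>, its \<open>q\<close>-th value is asymptotic to \<open>w q N\<close>, which dominates its lower norms.\<close>
  define R where "R N = (\<lambda>n. of_bool (n = N) + (\<Sum>i<q. - w i N * E i n))" for N
  define D where "D N = func q (R N)" for N
  have adm_R: "adm (R N)" for N
    unfolding R_def by (intro adm_add adm_unit adm_lincomb E) simp
  have func_R: "func j (R N) = w j N + (\<Sum>i<q. - w i N * func j (E i))" for j N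
  proof -
    have *: "\<And>i. i \<in> {..<q} \<Longrightarrow> adm (E i)" by (simp add: E)
    have "func j (R N) = func j (\<lambda>n. of_bool (n = N)) + func j (\<lambda>n. \<Sum>i<q. - w i N * E i n)"
      unfolding R_def by (rule func_add[OF adm_unit adm_lincomb[OF *]])
    also have "func j (\<lambda>n. \<Sum>i<q. - w i N * E i n) = (\<Sum>i<q. - w i N * func j (E i))"
      by (rule func_lincomb[OF *])
    finally show ?thesis by (simp only: func_unit)
  qed
  have func_R_0: "func j (R N) = 0" if "j < q" for j N
  proof -
    have "(\<Sum>i<q. - w i N * func j (E i)) = (\<Sum>i<q. if i = j then - w i N else 0)"
      using that by (intro sum.cong) (auto simp: dual)
    then show ?thesis using that by (simp add: func_R)
  qed
  have wnorm_R: "wnorm j (R N) \<le> norm (w j N) + (\<Sum>i<q. norm (w i N) * wnorm j (E i))" for j N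
  proof -
    have "wnorm j (R N) \<le> wnorm j (\<lambda>n. of_bool (n = N)) + wnorm j (\<lambda>n. \<Sum>i<q. - w i N * E i n)"
      unfolding R_def by (intro wnorm_add_le adm_unit adm_lincomb E) simp
    also have "wnorm j (\<lambda>n. \<Sum>i<q. - w i N * E i n) \<le> (\<Sum>i<q. wnorm j (\<lambda>n. - w i N * E i n))"
      by (intro wnorm_sum_le adm_cmult E) simp
    also have "\<dots> = (\<Sum>i<q. norm (w i N) * wnorm j (E i))"
      using E by (intro sum.cong refl) (simp add: wnorm_cmult[of "E _" j "- w _ N", simplified])
    finally show ?thesis by (simp add: wnorm_unit)
  qed
  have D_lim: "(\<lambda>N. D N / w q N) \<longlonglongrightarrow> 1"
  proof -
    have "(\<lambda>N. 1 + (\<Sum>i<q. - (w i N / w q N) * func q (E i))) \<longlonglongrightarrow> 1 + (\<Sum>i<q. - 0 * func q (E i))"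
      by (intro tendsto_intros w_ratio) simp
    moreover have "eventually (\<lambda>N. 1 + (\<Sum>i<q. - (w i N / w q N) * func q (E i)) = D N / w q N) sequentially"
      using w_eventually_nonzero[of q]
      by eventually_elim (simp add: D_def func_R add_divide_distrib diff_divide_distrib sum_divide_distrib sum_negf)
    ultimately show ?thesis
      by (simp add: Lim_transform_eventually)
  qed
  \<comment> \<open>The bound \<open>wnorm_R\<close> scaled by \<open>norm (a / D N)\<close>, with
    numerator and denominator divided by \<open>norm (w q N)\<close>. Only ratios remain: for
    \<open>j < q\<close> those in the bracket tend to 0, while \<open>D N / w q N\<close> tends to
    1.\<close>
  define B where "B j N = norm a / norm (D N / w q N) *
      (norm (w j N / w q N) + (\<Sum>i<q. norm (w i N / w q N) * wnorm j (E i)))" for j N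
  have "(\<lambda>N. B j N) \<longlonglongrightarrow> norm a / norm (1::complex) * (norm (0::complex) + (\<Sum>i<q. norm (0::complex) * wnorm j (E i)))"
    if "j < q" for j
    unfolding B_def using that by (intro tendsto_intros w_ratio D_lim) auto
  then have "eventually (\<lambda>N. B j N < e) sequentially" if "j < q" for j
    using that \<open>0 < e\<close> by (intro order_tendstoD(2)[of _ 0]) auto
  then have "eventually (\<lambda>N. \<forall>j\<in>{..<q}. B j N < e) sequentially"
    by (intro eventually_ball_finite) auto
  moreover have "eventually (\<lambda>N. D N / w q N \<noteq> 0) sequentially"
    using D_lim by (rule tendsto_imp_eventually_ne) simp
  ultimately have "eventually (\<lambda>N. (\<forall>j\<in>{..<q}. B j N < e) \<and> D N / w q N \<noteq> 0) sequentially"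
    by eventually_elim auto
  \<comment> \<open>Division by zero gives 0, so \<open>D N / w q N \<noteq> 0\<close> forces both
    \<open>D N\<close> and \<open>w q N\<close> to be nonzero.\<close>
  then obtain N where N: "\<And>j. j < q \<Longrightarrow> B j N < e" "D N \<noteq> 0" "w q N \<noteq> 0"
    by (auto simp: eventually_sequentially)
  show ?thesis
  proof (rule that)
    let ?c = "\<lambda>n. a / D N * R N n"
    show "adm ?c" by (intro adm_cmult adm_R)
    show "func j ?c = 0" if "j < q" for j
      using that by (simp only: func_cmult adm_R func_R_0 mult_zero_right)
    show "func q ?c = a"
      using N by (simp only: func_cmult adm_R D_def) simp
    show "wnorm j ?c \<le> e" if "j < q" for j
    proof -
      have "wnorm j ?c = norm (a / D N) * wnorm j (R N)"
        by (simp only: wnorm_cmult adm_R)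
      also have "\<dots> \<le> norm (a / D N) * (norm (w j N) + (\<Sum>i<q. norm (w i N) * wnorm j (E i)))"
        by (intro mult_left_mono wnorm_R) simp
      also have "\<dots> = B j N"
      proof -
        have "norm (w j N / w q N) + (\<Sum>i<q. norm (w i N / w q N) * wnorm j (E i))
            = (norm (w j N) + (\<Sum>i<q. norm (w i N) * wnorm j (E i))) / norm (w q N)"
          by (simp add: norm_divide add_divide_distrib sum_divide_distrib)
        then show ?thesis
          using N by (simp add: B_def norm_divide)
      qed
      finally show ?thesis using N(1)[OF that] by simp
    qed
  qed
qed

text \<open>Induction on \<open>q\<close>: a correction with \<open>a = 1\<close> is the new dual
  vector. Subtracting \<open>func q (E i)\<close> times it from each old vector kills the new value
  and keeps the old ones.\<close>

lemma dual_system_exists: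
  "\<exists>E. (\<forall>i<q. adm (E i)) \<and> (\<forall>i<q. \<forall>j<q. func j (E i) = of_bool (i = j))"
proof (induction q)
  case (Suc q)
  then obtain E where E: "\<And>i. i < q \<Longrightarrow> adm (E i)"
    "\<And>i j. i < q \<Longrightarrow> j < q \<Longrightarrow> func j (E i) = of_bool (i = j)" by blast
  obtain c where c: "adm c" "\<And>j. j < q \<Longrightarrow> func j c = 0" "func q c = 1"
    by (rule small_correction[of q E 1 1]) (simp_all add: E)
  let ?E = "\<lambda>i. if i = q then c else (\<lambda>n. E i n + (- func q (E i)) * c n)"
  have "adm (?E i)" if "i < Suc q" for i
  proof (cases "i = q")
    case False
    then show ?thesis
      using that E c by (simp only: if_False) (intro adm_add adm_cmult, auto)
  qed (simp add: c)
  moreover have "func j (?E i) = of_bool (i = j)" if "i < Suc q" "j < Suc q" for i j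
  proof (cases "i = q")
    case False
    then have "func j (?E i) = func j (E i) + (- func q (E i)) * func j c"
      using that E c by (simp only: if_False) (subst func_add, auto intro: adm_cmult simp only: func_cmult)
    also have "\<dots> = of_bool (i = j)"
      using that False E(2)[of i j] c by (cases "j = q") auto
    finally show ?thesis .
  qed (use that c in \<open>cases "j = q"; simp\<close>)
  ultimately show ?case by (intro exI[of _ ?E]) blast
qed simp

text \<open>The equations are solved one at a time. Correction \<open>q\<close> vanishes on the
  earlier equations and costs at most \<open>(1/2) ^ q\<close> in their norms, so the sum of all
  corrections converges absolutely in each row, and row \<open>i\<close> is affected only by the
  corrections up to \<open>i\<close>.\<close>

theorem polya_solution_exists:
  obtains c where "\<And>i. summable (\<lambda>n. norm (c n * w i n))" "\<And>i. (\<lambda>n. c n * w i n) sums b i"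
proof -
  have "\<exists>c. adm c \<and> (\<forall>j<q. func j c = 0) \<and> func q c = a \<and> (\<forall>j<q. wnorm j c \<le> (1/2) ^ q)" for q a
  proof -
    obtain E where E: "\<And>i. i < q \<Longrightarrow> adm (E i)"
      "\<And>i j. i < q \<Longrightarrow> j < q \<Longrightarrow> func j (E i) = of_bool (i = j)"
      using dual_system_exists[of q] by blast
    show ?thesis
      by (rule small_correction[of q E "(1/2) ^ q" a]) (auto simp: E)
  qed
  then obtain F where F: "\<And>q a. adm (F q a)" "\<And>q a j. j < q \<Longrightarrow> func j (F q a) = 0"
    "\<And>q a. func q (F q a) = a" "\<And>q a j. j < q \<Longrightarrow> wnorm j (F q a) \<le> (1/2) ^ q"
    by metis
  \<comment> \<open>\<open>S q\<close> is the sum of the first \<open>q\<close> corrections; the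
    next one supplies the defect left in equation \<open>q\<close>.\<close>
  define S where "S = rec_nat (\<lambda>_. 0) (\<lambda>q T n. T n + F q (b q - func q T) n)"
  define Q where "Q q = F q (b q - func q (S q))" for q
  have S_0: "S 0 = (\<lambda>_. 0)" and S_Suc: "S (Suc q) = (\<lambda>n. S q n + Q q n)" for q
    by (simp_all add: S_def Q_def)
  have adm_Q: "adm (Q q)" for q by (simp add: Q_def F)
  have adm_S: "adm (S q)" for q
    by (induction q) (simp_all add: S_0 S_Suc adm_zero adm_add adm_Q)
  have func_S: "func i (S q) = (\<Sum>p<q. func i (Q p))" for i q
    by (induction q) (simp_all add: S_0 S_Suc func_zero func_add adm_S adm_Q)
  have func_S_Suc: "func i (S (Suc i)) = b i" for i
    by (simp add: S_Suc func_add adm_S adm_Q) (simp add: Q_def F)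
  \<comment> \<open>The geometric bound for row \<open>i\<close> covers only the corrections
    \<open>q > i\<close>, so the comparison starts at \<open>Suc i\<close>.\<close>
  have wnorm_Q: "summable (\<lambda>q. wnorm i (Q q))" for i
    by (rule summable_comparison_test'[OF summable_geometric[of "1/2::real"], of "Suc i"])
      (auto simp: Q_def F wnorm_nonneg)
  have norm_Q: "(\<lambda>n. norm (Q q n * w i n)) summable_on UNIV" for q i
    using adm_summable_norm[OF adm_Q] by (simp add: summable_on_UNIV_nonneg_real_iff)
  have infsum_norm_Q: "(\<Sum>\<^sub>\<infinity>n. norm (Q q n * w i n)) = wnorm i (Q q)" for q i
    unfolding wnorm_def using norm_Q[of q i] by (intro infsumI norm_summable_imp_has_sum)
      (auto simp: summable_on_UNIV_nonneg_real_iff summable_sums)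
  \<comment> \<open>Absolute summability over pairs justifies exchanging the sums over corrections
    and unknowns.\<close>
  have double: "(\<lambda>(q, n). Q q n * w i n) summable_on UNIV \<times> UNIV" for i
  proof -
    have "(\<lambda>p. norm (case p of (q, n) \<Rightarrow> Q q n * w i n)) summable_on UNIV \<times> UNIV"
      unfolding Infinite_Sum.abs_summable_on_Sigma_iff using wnorm_Q[of i] norm_Q
      by (auto simp: infsum_norm_Q wnorm_nonneg adm_Q summable_on_UNIV_nonneg_real_iff)
    then show ?thesis by (rule Infinite_Sum.abs_summable_summable)
  qed
  define c where "c n = (\<Sum>\<^sub>\<infinity>q. Q q n)" for n
  \<comment> \<open>If \<open>w i n = 0\<close>, both sides are 0; otherwise the two sums converge
    or diverge together, a divergent \<open>infsum\<close> being 0.\<close>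
  have c_mult: "(\<Sum>\<^sub>\<infinity>q. Q q n * w i n) = c n * w i n" for i n
    unfolding c_def by (rule infsum_cmult_left')
  have double': "(\<lambda>(n, q). Q q n * w i n) summable_on UNIV \<times> UNIV" for i
    using double[of i] by (subst summable_on_swap) (simp add: case_prod_unfold)
  have c_summable: "(\<lambda>n. c n * w i n) summable_on UNIV" for i
    using summable_on_Sigma_banach[OF double'[of i]] by (simp add: c_mult)
  then have c_norm: "summable (\<lambda>n. norm (c n * w i n))" for i
  proof -
    have "(\<lambda>n. norm (c n * w i n)) summable_on UNIV"
      using c_summable[of i] by (simp only: summable_on_iff_abs_summable_on_complex)
    then show ?thesis by (simp only: summable_on_UNIV_nonneg_real_iff norm_ge_zero)
  qed
  have "(\<lambda>n. c n * w i n) sums b i" for i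
  proof -
    have sums_func: "(\<Sum>\<^sub>\<infinity>n. Q q n * w i n) = func i (Q q)" for q
      unfolding func_def using adm_summable_norm[OF adm_Q] adm_summable[OF adm_Q]
      by (intro infsumI norm_summable_imp_has_sum) (auto simp: summable_sums)
    have "(\<Sum>\<^sub>\<infinity>n. c n * w i n) = (\<Sum>\<^sub>\<infinity>n. \<Sum>\<^sub>\<infinity>q. Q q n * w i n)"
      by (simp add: c_mult)
    also have "\<dots> = (\<Sum>\<^sub>\<infinity>q. func i (Q q))"
      by (subst infsum_swap_banach[OF double']) (simp add: sums_func)
    also have "\<dots> = (\<Sum>\<^sub>\<infinity>q\<in>{..<Suc i}. func i (Q q))"
      by (rule infsum_cong_neutral) (auto simp: Q_def F)
    also have "\<dots> = b i" by (simp add: func_S[symmetric] func_S_Suc del: sum.lessThan_Suc)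
    finally have "((\<lambda>n. c n * w i n) has_sum b i) UNIV"
      using c_summable has_sum_infsum by metis
    then show ?thesis by (rule has_sum_imp_sums)
  qed
  with c_norm that show ?thesis by blast
qed

end

section \<open>Ordering the interpolation conditions\<close>

text \<open>Counting the values below \<open>x k\<close> gives \<open>k\<close> a finite rank, and
  ranks compare as the values do. Listing the ranks increasingly and inverting the rank map yields
  \<open>\<sigma>\<close>.\<close>

lemma increasing_reindexing:
  fixes x :: "nat \<Rightarrow> real"
  assumes "inj x" and fin: "\<And>k. finite {l. x l \<le> x k}"
  obtains \<sigma> :: "nat \<Rightarrow> nat" where "strict_mono (x \<circ> \<sigma>)" "surj \<sigma>"
proof -
  define r where "r k = card {l. x l < x k}" for k
  have fin': "finite {l. x l < x k}" for k
    by (rule finite_subset[OF _ fin[of k]]) auto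
  have r_less: "r k < r l" if "x k < x l" for k l
    unfolding r_def using that by (intro psubset_card_mono fin') auto
  have r_less_iff: "r k < r l \<longleftrightarrow> x k < x l" for k l
    using r_less[of k l] r_less[of l k] injD[OF \<open>inj x\<close>, of k l] by (cases "x k" "x l" rule: linorder_cases) auto
  have "inj r"
    by (rule injI) (metis r_less_iff injD[OF \<open>inj x\<close>] linorder_neqE_linordered_idom less_irrefl)
  then have inf: "infinite (range r)" using finite_imageD by blast
  define \<sigma> where "\<sigma> = inv r \<circ> enumerate (range r)"
  have r_\<sigma>: "r (\<sigma> n) = enumerate (range r) n" for n
    using enumerate_in_set[OF inf, of n] by (simp add: \<sigma>_def f_inv_into_f)
  show ?thesis
  proof
    show "strict_mono (x \<circ> \<sigma>)"
      by (rule strict_monoI) (simp add: r_less_iff[symmetric] r_\<sigma> inf enumerate_mono)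
    show "surj \<sigma>"
    proof (rule surjI)
      fix k show "\<sigma> (inv (enumerate (range r)) (r k)) = k"
        using \<open>inj r\<close> range_enumerate[OF inf] by (simp add: \<sigma>_def f_inv_into_f)
    qed
  qed
qed

text \<open>All derivative orders at one node precede the next node, so that each condition is
  asymptotically dominated by its successor, as Polya's theorem requires.\<close>

fun lex_node :: "(nat \<Rightarrow> nat) \<Rightarrow> nat \<Rightarrow> nat \<times> nat" where
  "lex_node m 0 = (0, 0)"
| "lex_node m (Suc q) = (let (k, j) = lex_node m q in if Suc j < m k then (k, Suc j) else (Suc k, 0))"

lemma lex_node_surj:
  assumes pos: "\<And>k. 0 < m k" and "j < m k"
  shows "\<exists>q. lex_node m q = (k, j)"
  using \<open>j < m k\<close>
proof (induction k arbitrary: j)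
  case 0
  then show ?case
  proof (induction j)
    case 0
    show ?case by (rule exI[of _ 0]) simp
  next
    case (Suc j)
    then obtain q where "lex_node m q = (0, j)" by auto
    with Suc show ?case by (intro exI[of _ "Suc q"]) simp
  qed
next
  case (Suc k)
  \<comment> \<open>As \<open>m k\<close> is positive, \<open>m k - 1\<close> is the last order at
    node \<open>k\<close>, and the next pair is \<open>(Suc k, 0)\<close>.\<close>
  obtain q0 where q0: "lex_node m q0 = (k, m k - 1)"
    using Suc.IH[of "m k - 1"] pos[of k] by auto
  from Suc.prems show ?case
  proof (induction j)
    case 0
    show ?case using q0 pos[of k] by (intro exI[of _ "Suc q0"]) simp
  next
    case (Suc j)
    then obtain q where "lex_node m q = (Suc k, j)" by auto
    with Suc show ?case by (intro exI[of _ "Suc q"]) simp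
  qed
qed

section \<open>Direction and growth of the exponents\<close>

text \<open>Compactness: if the directions stayed at distance \<open>e\<close> from \<open>s\<close>
  along a subsequence, a further subsequence would converge to a second limit direction.\<close>

lemma tendsto_unique_limit_direction:
  assumes dir: "limit_directions X = {s}" and x_in: "\<And>n. x n \<in> X"
    and x_lim: "filterlim x at_infinity sequentially"
  shows "(\<lambda>n. x n / of_real (norm (x n))) \<longlonglongrightarrow> s"
proof (rule ccontr)
  define u where "u n = x n / of_real (norm (x n))" for n
  assume "\<not> ?thesis"
  then obtain e where "e > 0" and "\<not> eventually (\<lambda>n. dist (u n) s < e) sequentially"
    by (auto simp: tendsto_iff u_def)
  then have "infinite {n. e \<le> dist (u n) s}"
    by (simp add: not_eventually not_less INFM_iff_infinite frequently_cofinite cofinite_eq_sequentially[symmetric])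
  then obtain r :: "nat \<Rightarrow> nat" where r: "strict_mono r" "\<And>n. e \<le> dist (u (r n)) s"
    using infinite_enumerate by blast
  \<comment> \<open>Where \<open>x n = 0\<close> the quotient is 0, hence the closed disc instead of
    the circle.\<close>
  have "u n \<in> cball 0 1" for n
    by (simp add: u_def norm_divide divide_self_if)
  then have "\<forall>n. (u \<circ> r) n \<in> cball 0 1" by simp
  then obtain l r' where l: "strict_mono r'" "(u \<circ> r \<circ> r') \<longlonglongrightarrow> l"
    using compact_cball[of "0::complex" 1, THEN compact_imp_seq_compact, THEN seq_compactE] by metis
  then have l_lim: "(\<lambda>n. u (r (r' n))) \<longlonglongrightarrow> l" by (simp add: comp_def)
  have "strict_mono (r \<circ> r')"
    using r l by (simp add: strict_mono_o)
  then have "filterlim (\<lambda>n. x (r (r' n))) at_infinity sequentially"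
    using filterlim_compose[OF x_lim filterlim_subseq] by (simp add: comp_def)
  with l_lim x_in have "l \<in> limit_directions X"
    by (auto simp: limit_directions_def u_def intro!: exI[of _ "\<lambda>n. x (r (r' n))"])
  then have "l = s" using dir by simp
  with l_lim have "eventually (\<lambda>n. dist (u (r (r' n))) s < e) sequentially"
    using \<open>e > 0\<close> by (simp add: tendsto_iff)
  then show False using r(2) by (simp add: not_le[symmetric])
qed

text \<open>Exponential growth overtakes linear growth. The linear bound later compares
  \<open>exp (- \<delta> * norm (lam n))\<close> with a geometric series.\<close>

lemma norm_ge_of_doubling:
  fixes x :: "nat \<Rightarrow> 'a::real_normed_vector"
  assumes growth: "\<And>n. norm (x (Suc n)) > 2 * norm (x n)"
  shows "eventually (\<lambda>n. real n \<le> norm (x n)) sequentially"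
proof -
  \<comment> \<open>The start is at index 1: \<open>x 0\<close> may vanish, but strict growth makes
    \<open>norm (x 1)\<close> positive.\<close>
  define a where "a = norm (x 1)"
  have "a > 0" unfolding a_def using le_less_trans[OF _ growth[of 0], of 0] by simp
  have pow: "2 ^ n * a \<le> norm (x (Suc n))" for n
  proof (induction n)
    case (Suc n)
    then show ?case using growth[of "Suc n"] by simp
  qed (simp add: a_def)
  have "(\<lambda>n. real n / 2 ^ n) \<longlonglongrightarrow> 0"
    using lim_n_over_pown[of "2::real"] by simp
  moreover have "(\<lambda>n. 1 / 2 ^ n :: real) \<longlonglongrightarrow> 0"
    using LIMSEQ_inverse_realpow_zero[of 2] by (simp add: inverse_eq_divide)
  ultimately have "(\<lambda>n. real n / 2 ^ n + 1 / 2 ^ n) \<longlonglongrightarrow> 0 + 0"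
    by (rule tendsto_add)
  then have "eventually (\<lambda>n. real n / 2 ^ n + 1 / 2 ^ n < a) sequentially"
    using \<open>a > 0\<close> by (intro order_tendstoD(2)[of _ "0 + 0"]) auto
  then have "eventually (\<lambda>n. real (Suc n) \<le> norm (x (Suc n))) sequentially"
  proof eventually_elim
    case (elim n)
    then have "real (Suc n) / 2 ^ n < a" by (simp add: add_divide_distrib)
    then have "real (Suc n) < 2 ^ n * a" by (simp add: divide_less_eq mult.commute)
    then show ?case using pow[of n] by simp
  qed
  then show ?thesis by (rule eventually_sequentially_Suc[THEN iffD1])
qed

section \<open>Exponential terms along the limit direction\<close>

lemma higher_deriv_exp_sum:
  "(deriv ^^ j) (\<lambda>z. \<Sum>n\<in>A. c n * exp (l n * z)) = (\<lambda>z. \<Sum>n\<in>A. c n * (l n ^ j * exp (l n * z)))"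
  for c l :: "nat \<Rightarrow> complex"
proof (induction j)
  case (Suc j)
  have "deriv (\<lambda>z. \<Sum>n\<in>A. c n * (l n ^ j * exp (l n * z))) z
      = (\<Sum>n\<in>A. c n * (l n ^ Suc j * exp (l n * z)))" for z
    by (rule DERIV_imp_deriv) (auto intro!: derivative_eq_intros sum.cong)
  with Suc show ?case by simp
qed simp

locale exponents =
  fixes lam :: "nat \<Rightarrow> complex" and s :: complex
  assumes norm_direction: "norm s = 1"
    and direction: "(\<lambda>n. lam n / of_real (norm (lam n))) \<longlonglongrightarrow> s"
    and norm_ge: "eventually (\<lambda>n. real n \<le> norm (lam n)) sequentially"
begin

lemma norm_at_top: "filterlim (\<lambda>n. norm (lam n)) at_top sequentially"
  by (rule filterlim_at_top_mono[OF filterlim_real_sequentially norm_ge])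

lemma lam_eventually_nonzero: "eventually (\<lambda>n. lam n \<noteq> 0) sequentially"
  using norm_ge eventually_gt_at_top[of 0] by eventually_elim auto

text \<open>\<open>Re (lam n * z) / norm (lam n)\<close> tends to the negative number
  \<open>Re (s * z)\<close>, so half of that limit is eventually an upper bound.\<close>

lemma decay:
  assumes "Re (s * z) < 0"
  obtains \<delta> where "\<delta> > 0" "eventually (\<lambda>n. Re (lam n * z) \<le> - \<delta> * norm (lam n)) sequentially"
proof
  let ?\<delta> = "- Re (s * z) / 2"
  show "?\<delta> > 0" using assms by simp
  have "(\<lambda>n. Re (lam n / of_real (norm (lam n)) * z)) \<longlonglongrightarrow> Re (s * z)"
    by (intro tendsto_intros direction)
  then have "eventually (\<lambda>n. Re (lam n / of_real (norm (lam n)) * z) < - ?\<delta>) sequentially"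
    by (rule order_tendstoD(2)) (use assms in linarith)
  then show "eventually (\<lambda>n. Re (lam n * z) \<le> - ?\<delta> * norm (lam n)) sequentially"
    using lam_eventually_nonzero
  proof eventually_elim
    case (elim n)
    have "Re (lam n / of_real (norm (lam n)) * z) = Re (lam n * z / of_real (norm (lam n)))"
      by (simp only: times_divide_eq_left)
    also have "\<dots> = Re (lam n * z) / norm (lam n)"
      by (rule Re_divide_of_real)
    finally have "Re (lam n * z) / norm (lam n) < - ?\<delta>" using elim(1) by simp
    then show ?case using elim(2) by (simp add: divide_less_eq)
  qed
qed

text \<open>Passing from \<open>p\<close> to \<open>\<mu>\<close> gains
  \<open>\<delta> * norm (lam n)\<close> by \<open>decay\<close>; moving from \<open>\<mu>\<close>
  to \<open>z\<close> loses at most \<open>norm (lam n) * norm (z - \<mu>)\<close>. Hence the radius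
  \<open>\<delta>\<close> works for all large \<open>n\<close>.\<close>

lemma uniform_comparison:
  assumes "Re (s * \<mu>) < Re (s * p)"
  obtains r where "r > 0"
    "eventually (\<lambda>n. \<forall>z\<in>ball \<mu> r. Re (lam n * z) \<le> Re (lam n * p)) sequentially"
proof -
  have "Re (s * (\<mu> - p)) < 0" using assms by (simp add: algebra_simps)
  then obtain \<delta> where \<delta>: "\<delta> > 0"
    "eventually (\<lambda>n. Re (lam n * (\<mu> - p)) \<le> - \<delta> * norm (lam n)) sequentially"
    by (rule decay)
  from \<delta>(2) have "eventually (\<lambda>n. \<forall>z\<in>ball \<mu> \<delta>. Re (lam n * z) \<le> Re (lam n * p)) sequentially"
  proof eventually_elim
    case (elim n)
    show ?case
    proof
      fix z assume "z \<in> ball \<mu> \<delta>"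
      then have "norm (z - \<mu>) \<le> \<delta>" by (simp add: dist_norm norm_minus_commute)
      then have "Re (lam n * (z - \<mu>)) \<le> norm (lam n) * \<delta>"
        using complex_Re_le_cmod[of "lam n * (z - \<mu>)"] mult_left_mono[of "norm (z - \<mu>)" \<delta> "norm (lam n)"]
        by (simp only: norm_mult) simp
      moreover have "lam n * z = lam n * p + lam n * (\<mu> - p) + lam n * (z - \<mu>)"
        by (simp add: algebra_simps)
      then have "Re (lam n * z) = Re (lam n * p) + Re (lam n * (\<mu> - p)) + Re (lam n * (z - \<mu>))"
        by (simp only: plus_complex.sel)
      ultimately show "Re (lam n * z) \<le> Re (lam n * p)"
        using elim by (simp add: mult.commute)
    qed
  qed
  with \<delta>(1) that show ?thesis by blast
qed

lemma tendsto_power_exp_0: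
  assumes "Re (s * z) < 0"
  shows "(\<lambda>n. lam n ^ j * exp (lam n * z)) \<longlonglongrightarrow> 0"
proof -
  obtain \<delta> where \<delta>: "\<delta> > 0" "eventually (\<lambda>n. Re (lam n * z) \<le> - \<delta> * norm (lam n)) sequentially"
    using assms by (rule decay)
  have "filterlim (\<lambda>n. \<delta> * norm (lam n)) at_top sequentially"
    using \<delta> norm_at_top by (intro filterlim_tendsto_pos_mult_at_top[OF tendsto_const])
  from filterlim_compose[OF tendsto_power_div_exp_0 this]
  have "(\<lambda>n. (\<delta> * norm (lam n)) ^ j / exp (\<delta> * norm (lam n)) / \<delta> ^ j) \<longlonglongrightarrow> 0 / \<delta> ^ j"
    using \<delta> by (intro tendsto_divide tendsto_const) auto
  then have lim: "(\<lambda>n. norm (lam n) ^ j * exp (- \<delta> * norm (lam n))) \<longlonglongrightarrow> 0"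
    using \<delta> by (simp add: power_mult_distrib exp_minus field_simps)
  show ?thesis
  proof (rule Lim_null_comparison[OF _ lim])
    show "eventually (\<lambda>n. norm (lam n ^ j * exp (lam n * z)) \<le> norm (lam n) ^ j * exp (- \<delta> * norm (lam n))) sequentially"
      using \<delta>(2) by eventually_elim (simp only: norm_mult norm_power norm_exp_eq_Re, intro mult_left_mono, auto)
  qed
qed

lemma summable_norm_exp:
  assumes "Re (s * z) < 0"
  shows "summable (\<lambda>n. norm (exp (lam n * z)))"
proof -
  obtain \<delta> where \<delta>: "\<delta> > 0" "eventually (\<lambda>n. Re (lam n * z) \<le> - \<delta> * norm (lam n)) sequentially"
    using assms by (rule decay)
  have "eventually (\<lambda>n. norm (norm (exp (lam n * z))) \<le> exp (- \<delta>) ^ n) sequentially"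
    using \<delta>(2) norm_ge
  proof eventually_elim
    case (elim n)
    have "Re (lam n * z) \<le> real n * - \<delta>"
      using elim \<delta>(1) by (smt (verit) mult_left_mono mult_minus_left mult.commute)
    then show ?case by (simp only: norm_exp_eq_Re exp_of_nat_mult[symmetric]) simp
  qed
  then show ?thesis
    by (rule summable_comparison_test_ev) (use \<delta>(1) in \<open>auto intro: summable_geometric\<close>)
qed

section \<open>Necessity of finiteness below each node\<close>

lemma finite_below_of_interp_soluble:
  assumes sol: "interp_soluble lam mu m" and pos: "\<And>k. 0 < m k"
  shows "finite {k. Re (s * mu k) \<le> Re (s * mu k0)}"
proof (rule ccontr)
  assume inf: "infinite {k. Re (s * mu k) \<le> Re (s * mu k0)}"
  \<comment> \<open>Since \<open>s * cnj s = 1\<close>, a step along \<open>cnj s\<close> raises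
    \<open>Re (s * z)\<close> at unit rate, so \<open>p i\<close> lies beyond \<open>mu k0\<close>
    by \<open>1 / Suc i\<close>.\<close>
  define p where "p i = mu k0 + cnj s / of_nat (Suc i)" for i
  define \<Phi> where "\<Phi> k i = (\<Sum>n. norm (exp (lam n * (mu k - p i))))" for k i
  \<comment> \<open>The sum over \<open>i \<le> k\<close> covers every fixed \<open>i\<close> once
    \<open>k\<close> is large, and the factor \<open>k\<close> outgrows any constant. The absolute
    values guard against nodes beyond \<open>p i\<close>, where the series for
    \<open>\<Phi> k i\<close> may diverge; the added 1 makes the final inequality strict.\<close>
  define b where "b k = real k * (1 + (\<Sum>i\<le>k. \<bar>\<Phi> k i\<bar>))" for k
  have "s * cnj s = 1"
    using norm_direction by (simp add: complex_norm_square[symmetric])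
  then have Re_p: "Re (s * p i) = Re (s * mu k0) + 1 / real (Suc i)" for i
    by (simp add: p_def distrib_left del: times_complex.sel of_nat_Suc)
  obtain c where conv: "\<forall>k. \<exists>r>0. \<forall>z\<in>ball (mu k) r. summable (\<lambda>n. norm (c n * exp (lam n * z)))"
    and val: "\<forall>k j. j < m k \<longrightarrow> (deriv ^^ j) (exp_series c lam) (mu k) = of_real (b k)"
    using sol[unfolded interp_soluble_def, THEN spec, of "\<lambda>k j. of_real (b k)"] by (elim exE conjE)
  obtain r where r: "r > 0" "\<And>z. z \<in> ball (mu k0) r \<Longrightarrow> summable (\<lambda>n. norm (c n * exp (lam n * z)))"
    using conv[THEN spec, of k0] by (elim exE conjE) blast
  obtain i where i: "1 / real (Suc i) < r" using r(1) nat_approx_posE by metis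
  have "p i \<in> ball (mu k0) r"
    using i norm_direction by (simp add: p_def dist_norm norm_divide del: of_nat_Suc)
  then have sum_p: "summable (\<lambda>n. norm (c n * exp (lam n * p i)))" by (rule r(2))
  then obtain C where C: "\<And>n. norm (c n * exp (lam n * p i)) \<le> C"
    using summable_imp_Bseq[OF sum_p] by (auto simp: Bseq_def)
  \<comment> \<open>\<open>i\<close> and \<open>C\<close> depend on the solution, but the data were
    fixed before; a late enough node among the infinitely many below handles both.\<close>
  obtain k where k: "Re (s * mu k) \<le> Re (s * mu k0)" "i \<le> k" "C < real k" "0 < k"
  proof -
    have "\<exists>k. k \<in> {k. Re (s * mu k) \<le> Re (s * mu k0)} \<and> i + nat \<lceil>C\<rceil> < k"
      using inf[unfolded infinite_nat_iff_unbounded] by blast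
    then obtain k where "Re (s * mu k) \<le> Re (s * mu k0)" "i + nat \<lceil>C\<rceil> < k" by blast
    moreover from this have "C < real k" by linarith
    ultimately show ?thesis by (intro that[of k]) auto
  qed
  have "Re (s * (mu k - p i)) < 0"
  proof -
    have "Re (s * mu k) < Re (s * p i)"
      unfolding Re_p using k(1) by (rule order_le_less_trans) simp
    then show ?thesis by (simp add: right_diff_distrib)
  qed
  then have sum_\<Phi>: "summable (\<lambda>n. norm (exp (lam n * (mu k - p i))))"
    by (rule summable_norm_exp)
  have term_le: "norm (c n * exp (lam n * mu k)) \<le> C * norm (exp (lam n * (mu k - p i)))" for n
  proof -
    have "c n * exp (lam n * mu k) = (c n * exp (lam n * p i)) * exp (lam n * (mu k - p i))"
      by (simp add: exp_add[symmetric] algebra_simps)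
    then show ?thesis using C[of n] by (simp only: norm_mult) (intro mult_right_mono, auto simp: norm_mult)
  qed
  have sum_k: "summable (\<lambda>n. norm (c n * exp (lam n * mu k)))"
    by (rule summable_comparison_test'[OF summable_mult[OF sum_\<Phi>, of C], of 0]) (use term_le in auto)
  have "b k \<le> norm (exp_series c lam (mu k))"
    using val[rule_format, OF pos[of k]] by (simp del: of_real_mult)
  also have "\<dots> \<le> (\<Sum>n. norm (c n * exp (lam n * mu k)))"
    unfolding exp_series_def by (rule summable_norm[OF sum_k])
  also have "\<dots> \<le> (\<Sum>n. C * norm (exp (lam n * (mu k - p i))))"
    by (intro suminf_le term_le sum_k summable_mult sum_\<Phi>)
  also have "\<dots> = C * \<Phi> k i"
    unfolding \<Phi>_def by (rule suminf_mult[OF sum_\<Phi>])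
  also have "\<dots> \<le> real k * \<bar>\<Phi> k i\<bar>"
  proof -
    have "0 \<le> \<Phi> k i" unfolding \<Phi>_def by (rule suminf_nonneg[OF sum_\<Phi>]) simp
    then show ?thesis using k(3) by (intro mult_mono) auto
  qed
  also have "\<dots> < b k"
  proof -
    have "\<bar>\<Phi> k i\<bar> \<le> (\<Sum>i\<le>k. \<bar>\<Phi> k i\<bar>)"
      using k(2) by (intro member_le_sum) auto
    then show ?thesis unfolding b_def using k(4) by (intro mult_strict_left_mono) auto
  qed
  finally show False by simp
qed

section \<open>Sufficiency of finiteness below each node\<close>

text \<open>Absolute convergence at a point \<open>p\<close> beyond \<open>\<mu>\<close> dominates
  the terms near \<open>\<mu>\<close>, so the M-test gives uniform convergence there. The partial
  sums are entire, hence the series may be differentiated termwise.\<close>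

lemma higher_deriv_exp_series:
  assumes lt: "Re (s * \<mu>) < Re (s * p)" and sum_p: "summable (\<lambda>n. norm (c n * exp (lam n * p)))"
    and deriv_sums: "(\<lambda>n. c n * (lam n ^ j * exp (lam n * \<mu>))) sums b"
  shows "(deriv ^^ j) (exp_series c lam) \<mu> = b"
    and "\<exists>r>0. \<forall>z\<in>ball \<mu> r. summable (\<lambda>n. norm (c n * exp (lam n * z)))"
proof -
  obtain r where "r > 0" and
    r: "eventually (\<lambda>n. \<forall>z\<in>ball \<mu> r. Re (lam n * z) \<le> Re (lam n * p)) sequentially"
    using lt by (rule uniform_comparison)
  from r have bound: "eventually (\<lambda>n. \<forall>z\<in>ball \<mu> r. norm (c n * exp (lam n * z)) \<le> norm (c n * exp (lam n * p))) sequentially"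
    by eventually_elim (simp add: norm_mult mult_left_mono)
  have "summable (\<lambda>n. norm (c n * exp (lam n * z)))" if "z \<in> ball \<mu> r" for z
    by (rule summable_comparison_test_ev[OF _ sum_p])
      (use bound that in \<open>auto elim!: eventually_mono\<close>)
  with \<open>r > 0\<close> show "\<exists>r>0. \<forall>z\<in>ball \<mu> r. summable (\<lambda>n. norm (c n * exp (lam n * z)))" by blast
  have "uniform_limit (ball \<mu> r) (\<lambda>N z. \<Sum>n<N. c n * exp (lam n * z)) (exp_series c lam) sequentially"
    unfolding exp_series_def by (rule Weierstrass_m_test_ev[OF bound sum_p])
  then have "(\<lambda>N. (deriv ^^ j) (\<lambda>z. \<Sum>n<N. c n * exp (lam n * z)) \<mu>) \<longlonglongrightarrow> (deriv ^^ j) (exp_series c lam) \<mu>"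
    by (rule higher_deriv_complex_uniform_limit)
      (use \<open>r > 0\<close> in \<open>auto intro!: always_eventually holomorphic_intros\<close>)
  then have "(\<lambda>n. c n * (lam n ^ j * exp (lam n * \<mu>))) sums (deriv ^^ j) (exp_series c lam) \<mu>"
    by (simp add: sums_def higher_deriv_exp_sum)
  then show "(deriv ^^ j) (exp_series c lam) \<mu> = b"
    using deriv_sums by (rule sums_unique2)
qed

lemma interp_soluble_of_finite_below:
  assumes inj: "inj (\<lambda>k. Re (s * mu k))" and pos: "\<And>k. 0 < m k"
    and fin: "\<And>k0. finite {k. Re (s * mu k) \<le> Re (s * mu k0)}"
  shows "interp_soluble lam mu m"
  unfolding interp_soluble_def
proof
  fix b :: "nat \<Rightarrow> nat \<Rightarrow> complex"
  obtain \<sigma> :: "nat \<Rightarrow> nat" where mono: "strict_mono ((\<lambda>k. Re (s * mu k)) \<circ> \<sigma>)" and "surj \<sigma>"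
    by (rule increasing_reindexing[OF inj fin])
  define \<nu> where "\<nu> k = mu (\<sigma> k)" for k
  have \<nu>_less: "Re (s * \<nu> k) < Re (s * \<nu> (Suc k))" for k
    using strict_monoD[OF mono, of k "Suc k"] by (simp add: \<nu>_def)
  define lx where "lx = lex_node (m \<circ> \<sigma>)"
  define w where "w q n = (case lx q of (k, j) \<Rightarrow> lam n ^ j * exp (lam n * \<nu> k))" for q n
  interpret polya_system w
  proof
    show "w 0 n \<noteq> 0" for n by (simp add: w_def lx_def)
    show nz: "eventually (\<lambda>n. w q n \<noteq> 0) sequentially" for q
      using lam_eventually_nonzero by eventually_elim (simp add: w_def split: prod.split)
    show "(\<lambda>n. w q n / w (Suc q) n) \<longlonglongrightarrow> 0" for q
    proof -
      obtain k j where kj: "lx q = (k, j)" by fastforce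
      show ?thesis
      \<comment> \<open>Another derivative at the same node gives the ratio
        \<open>1 / lam n\<close>; a change of node gives a power of \<open>lam n\<close> times a
        decaying exponential.\<close>
      proof (cases "Suc j < m (\<sigma> k)")
        case True
        then have "lx (Suc q) = (k, Suc j)" using kj by (simp add: lx_def)
        then have *: "w q n / w (Suc q) n = inverse (lam n)" if "lam n \<noteq> 0" for n
          using kj that by (simp add: w_def field_simps)
        have "filterlim lam at_infinity sequentially"
          using norm_at_top by (rule filterlim_norm_at_top_imp_at_infinity)
        then have "(\<lambda>n. inverse (lam n)) \<longlonglongrightarrow> 0"
          by (rule filterlim_compose[OF tendsto_inverse_0])
        then show ?thesis
          by (rule Lim_transform_eventually) (use lam_eventually_nonzero in eventually_elim, simp add: *)
      next
        case False
        then have "lx (Suc q) = (Suc k, 0)" using kj by (simp add: lx_def)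
        then have "w q n / w (Suc q) n = lam n ^ j * exp (lam n * (\<nu> k - \<nu> (Suc k)))" for n
          using kj by (simp add: w_def right_diff_distrib exp_diff)
        moreover have "Re (s * (\<nu> k - \<nu> (Suc k))) < 0"
          using \<nu>_less[of k] by (simp add: right_diff_distrib)
        ultimately show ?thesis using tendsto_power_exp_0 by simp
      qed
    qed
  qed
  have lx_surj: "\<exists>q. lx q = (k, j)" if "j < m (\<sigma> k)" for k j
    unfolding lx_def by (rule lex_node_surj) (use pos that in auto)
  obtain c where c: "\<And>q. summable (\<lambda>n. norm (c n * w q n))"
    "\<And>q. (\<lambda>n. c n * w q n) sums (case lx q of (k, j) \<Rightarrow> b (\<sigma> k) j)"
    by (rule polya_solution_exists[of "\<lambda>q. case lx q of (k, j) \<Rightarrow> b (\<sigma> k) j"]) blast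
  \<comment> \<open>The condition of order 0, present at every node, carries the absolute
    convergence of the series itself.\<close>
  have summable_\<nu>: "summable (\<lambda>n. norm (c n * exp (lam n * \<nu> k)))" for k
  proof -
    obtain q where "lx q = (k, 0)" using lx_surj[of 0 k, OF pos] by blast
    with c(1)[of q] show ?thesis by (simp add: w_def)
  qed
  have sums_\<nu>: "(\<lambda>n. c n * (lam n ^ j * exp (lam n * \<nu> k))) sums b (\<sigma> k) j" if j: "j < m (\<sigma> k)" for j k
  proof -
    obtain q where "lx q = (k, j)" using lx_surj[OF j] by blast
    with c(2)[of q] show ?thesis by (simp add: w_def)
  qed
  show "\<exists>c. (\<forall>k. \<exists>r>0. \<forall>z\<in>ball (mu k) r. summable (\<lambda>n. norm (c n * exp (lam n * z)))) \<and>
      (\<forall>k j. j < m k \<longrightarrow> (deriv ^^ j) (exp_series c lam) (mu k) = b k j)"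
  proof (intro exI[of _ c] conjI allI impI)
    fix k
    obtain k' where k': "k = \<sigma> k'" using \<open>surj \<sigma>\<close> by blast
    \<comment> \<open>The next node \<open>\<nu> (Suc k')\<close> serves as the point
      \<open>p\<close> beyond \<open>\<nu> k'\<close>.\<close>
    show "\<exists>r>0. \<forall>z\<in>ball (mu k) r. summable (\<lambda>n. norm (c n * exp (lam n * z)))"
      using higher_deriv_exp_series(2)[OF \<nu>_less[of k'] summable_\<nu> sums_\<nu>[of 0]] pos by (simp add: k' \<nu>_def)
    show "(deriv ^^ j) (exp_series c lam) (mu k) = b k j" if "j < m k" for j
      using higher_deriv_exp_series(1)[OF \<nu>_less[of k'] summable_\<nu> sums_\<nu>[of j]] that by (simp add: k' \<nu>_def)
  qed
qed

end

section \<open>Finiteness below each node as a limit, and the conclusion\<close>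

text \<open>An infinite supremum puts some \<open>x k0\<close> above any given \<open>C\<close>, and
  all but finitely many terms exceed that \<open>x k0\<close>. On the naturals,
  \<open>sequentially\<close> is the cofinite filter.\<close>

lemma finite_below_iff_at_top:
  fixes x :: "nat \<Rightarrow> real"
  assumes "(SUP k. ereal (x k)) = \<infinity>"
  shows "(\<forall>k0. finite {k. x k \<le> x k0}) \<longleftrightarrow> filterlim x at_top sequentially"
proof
  assume fin: "\<forall>k0. finite {k. x k \<le> x k0}"
  show "filterlim x at_top sequentially"
    unfolding filterlim_at_top
  proof
    fix C
    have "ereal C < (SUP k. ereal (x k))" using assms by simp
    then obtain k0 where k0: "C < x k0" by (auto simp: less_SUP_iff)
    have "eventually (\<lambda>k. k \<notin> {k. x k \<le> x k0}) sequentially"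
      unfolding cofinite_eq_sequentially[symmetric] eventually_cofinite using fin by simp
    then show "eventually (\<lambda>k. C \<le> x k) sequentially"
      by eventually_elim (use k0 in auto)
  qed
next
  assume lim: "filterlim x at_top sequentially"
  show "\<forall>k0. finite {k. x k \<le> x k0}"
  proof
    fix k0
    have "eventually (\<lambda>k. x k0 < x k) cofinite"
      using lim unfolding filterlim_at_top_dense cofinite_eq_sequentially by blast
    then show "finite {k. x k \<le> x k0}"
      by (simp add: eventually_cofinite not_less)
  qed
qed

text \<open>A finite sublevel set omits some index, so no term attains the supremum; anything below
  the supremum lies below some \<open>x k0\<close>, hence below almost all terms. Conversely,
  convergence to a supremum above \<open>x k0\<close> leaves only finitely many terms at or below
  \<open>x k0\<close>.\<close>

lemma finite_below_iff_tendsto_SUP: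
  fixes x :: "nat \<Rightarrow> ereal"
  shows "(\<forall>k0. finite {k. x k \<le> x k0}) \<longleftrightarrow> (\<forall>k. x k < (SUP k. x k)) \<and> x \<longlonglongrightarrow> (SUP k. x k)"
proof
  assume fin: "\<forall>k0. finite {k. x k \<le> x k0}"
  show "(\<forall>k. x k < (SUP k. x k)) \<and> x \<longlonglongrightarrow> (SUP k. x k)"
  proof
    show "\<forall>k. x k < (SUP k. x k)"
    proof
      fix k0
      have "{k. x k \<le> x k0} \<noteq> UNIV" using fin infinite_UNIV_nat by metis
      then obtain k where "\<not> x k \<le> x k0" by blast
      then have "x k0 < x k" by (simp only: not_le)
      then show "x k0 < (SUP k. x k)" by (rule less_le_trans) (simp add: SUP_upper)
    qed
    show "x \<longlonglongrightarrow> (SUP k. x k)"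
    proof (rule order_tendstoI)
      fix a assume "a < (SUP k. x k)"
      then obtain k0 where k0: "a < x k0" by (auto simp: less_SUP_iff)
      have "eventually (\<lambda>k. k \<notin> {k. x k \<le> x k0}) sequentially"
        unfolding cofinite_eq_sequentially[symmetric] eventually_cofinite using fin by simp
      then show "eventually (\<lambda>k. a < x k) sequentially"
        by eventually_elim (use k0 in auto)
    next
      fix a assume "(SUP k. x k) < a"
      then show "eventually (\<lambda>k. x k < a) sequentially"
        by (intro always_eventually allI) (meson SUP_upper UNIV_I le_less_trans)
    qed
  qed
next
  assume lim: "(\<forall>k. x k < (SUP k. x k)) \<and> x \<longlonglongrightarrow> (SUP k. x k)"
  show "\<forall>k0. finite {k. x k \<le> x k0}"
  proof
    fix k0
    have "eventually (\<lambda>k. x k0 < x k) cofinite"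
      using lim unfolding cofinite_eq_sequentially by (blast intro: order_tendstoD(1))
    then show "finite {k. x k \<le> x k0}"
      by (simp add: eventually_cofinite not_less)
  qed
qed

theorem theorem2:
  fixes Lam :: "complex set" and s :: complex
    and lam :: "nat \<Rightarrow> complex" and mu :: "nat \<Rightarrow> complex" and m :: "nat \<Rightarrow> nat"
  assumes unb: "\<not> bounded Lam"
    and dir: "limit_directions Lam = {s}"
    and lam_in: "\<And>n. lam n \<in> Lam"
    and lam_growth: "\<And>n. norm (lam (Suc n)) > 2 * norm (lam n)"
    and mu_inj: "inj mu"
    and mult_pos: "\<And>k. m k \<ge> 1"
    and no_acc: "\<And>k. \<not> (mu k islimpt range mu)"
    and lines: "\<And>k l. Re (s * mu k) = Re (s * mu l) \<Longrightarrow> k = l"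
  defines "d \<equiv> (SUP k. ereal (Re (s * mu k)))"
  shows "(d = \<infinity> \<longrightarrow>
            (interp_soluble lam mu m \<longleftrightarrow> filterlim (\<lambda>k. Re (s * mu k)) at_top sequentially))
       \<and> (d \<noteq> \<infinity> \<longrightarrow>
            (interp_soluble lam mu m \<longleftrightarrow>
               (\<forall>k. ereal (Re (s * mu k)) < d) \<and> (\<lambda>k. ereal (Re (s * mu k))) \<longlonglongrightarrow> d))"
proof -
  have norm_ge: "eventually (\<lambda>n. real n \<le> norm (lam n)) sequentially"
    using lam_growth by (rule norm_ge_of_doubling)
  then have "filterlim lam at_infinity sequentially"
    by (intro filterlim_norm_at_top_imp_at_infinity filterlim_at_top_mono[OF filterlim_real_sequentially])
  with dir lam_in have direction: "(\<lambda>n. lam n / of_real (norm (lam n))) \<longlonglongrightarrow> s"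
    by (intro tendsto_unique_limit_direction)
  \<comment> \<open>The quotients have norm 1 as soon as \<open>lam n\<close> is nonzero, which
    holds eventually.\<close>
  have "norm s = 1"
  proof (rule LIMSEQ_unique)
    show "(\<lambda>n. norm (lam n / of_real (norm (lam n)))) \<longlonglongrightarrow> norm s"
      using direction by (rule tendsto_norm)
    have "eventually (\<lambda>n. 1 = norm (lam n / of_real (norm (lam n)))) sequentially"
      using norm_ge eventually_gt_at_top[of 0] by eventually_elim (auto simp: norm_divide)
    then show "(\<lambda>n. norm (lam n / of_real (norm (lam n)))) \<longlonglongrightarrow> 1"
      by (rule Lim_transform_eventually[OF tendsto_const])
  qed
  then interpret exponents lam s
    using direction norm_ge by unfold_locales
  have inj: "inj (\<lambda>k. Re (s * mu k))"
    by (rule injI) (rule lines)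
  have pos: "0 < m k" for k using mult_pos[of k] by simp
  have "interp_soluble lam mu m \<longleftrightarrow> (\<forall>k0. finite {k. Re (s * mu k) \<le> Re (s * mu k0)})"
  proof
    assume "interp_soluble lam mu m"
    then show "\<forall>k0. finite {k. Re (s * mu k) \<le> Re (s * mu k0)}"
      using pos by (intro allI finite_below_of_interp_soluble)
  next
    assume "\<forall>k0. finite {k. Re (s * mu k) \<le> Re (s * mu k0)}"
    then show "interp_soluble lam mu m"
      by (intro interp_soluble_of_finite_below inj pos) (erule spec)
  qed
  \<comment> \<open>The first equivalence settles \<open>d = \<infinity>\<close>, the second finite
    \<open>d\<close>; \<open>ereal_less_eq\<close> identifies the real and extended real sublevel
    sets.\<close>
  then show ?thesis
    using finite_below_iff_at_top[of "\<lambda>k. Re (s * mu k)"]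
      finite_below_iff_tendsto_SUP[of "\<lambda>k. ereal (Re (s * mu k))"]
    unfolding d_def ereal_less_eq by simp
qed

end
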